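(* Let $\mathbf n=(n_k)_{k\ge1}$ be a strictly increasing sequence of positive integers and let $\mathcal B$ be a basis of a Banach space $X$. The following statements are equivalent: (i) $\mathcal B$ is ($\mathbf n$, almost greedy). (ii) There exists a constant $C\ge1$ such that $\|x-G_m(x)\|\le C\min_{0\le k\le m}\check{\sigma}^{\mathbf n}_k(x)$ for all $x\in X$, all $m\in\mathbb N$ and all choices of $G_m(x)$, where $\check{\sigma}^{\mathbf n}_k(x)=\inf\{\|x-P_I(x)\|: I\in\mathcal I^{\mathbf n,(k)}\}$. (iii) $\mathcal B$ is ($\mathbf n$, consecutive almost greedy) of type I, i.e. there exists a constant $C\ge1$ such that $\|x-G_m(x)\|\le C\,\check{\sigma}^{\mathbf n}_m(x)$ for all $x\in X$, all $m\in\mathbb N$ and all choices of $G_m(x)$.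
   Context: $X$ is a separable infinite-dimensional Banach space over $\mathbb F=\mathbb R$ or $\mathbb C$; $\mathbb N=\{1,2,\dots\}$. A basis of $X$ is a sequence $\mathcal B=(e_n)_{n\ge1}\subset X$ whose linear span is norm-dense and for which there is a sequence $(e_n^* )_{n\ge1}\subset X^*$ with $e_j^*(e_k)=\delta_{j,k}$ and $0<\inf_n\{\|e_n\|,\|e_n^*\|\}\le\sup_n\{\|e_n\|,\|e_n^*\|\}<\infty$ (then $e_n^*(x)\to0$ for every $x$). The sequence $\mathbf n$ is identified with its set of terms. For a finite set $A\subset\mathbb N$, $P_A(x)=\sum_{n\in A}e_n^*(x)e_n$. For $x\in X$, $m\in\mathbb N$, a greedy set of $x$ of order $m$ is a set $A\subset\mathbb N$ with $|A|=m$ and $\min_{n\in A}|e_n^*(x)|\ge\max_{n\notin A}|e_n^*(x)|$; $G_m(x)$ denotes $P_A(x)$ for such an $A$ (not necessarily unique). $\mathcal B$ is ($\mathbf n$, almost greedy) if there is $C\ge1$ with $\|x-G_m(x)\|\le C\,\widetilde\sigma^{\mathbf n}_m(x)$ for all $x\in X$, $m\in\mathbb N$ and all choices of $G_m(x)$, where $\widetilde\sigma^{\mathbf n}_m(x)=\inf\{\|x-P_A(x)\|:A\subset\mathbf n,\ |A|=m\}$. For an integer $m\ge0$, $\mathcal I^{\mathbf n,(m)}$ is the collection of sets of the form $\{n_{k+1},n_{k+2},\dots,n_{k+m}\}$ with $k\ge0$ (for $m=0$ only the empty set). The symbol $\check{\sigma}$ is just a name ("sigma check") for the quantity defined in the claim.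 *)

theory Defs
  imports "HOL-Analysis.Analysis"
begin

text \<open>
  The scalar field is \<open>\<real>\<close> or \<open>\<complex>\<close>, treated uniformly: the members of the following class are,
  up to isometric isomorphism, exactly these two fields (on a two-dimensional member the
  multiplicative norm is forced to be the usual modulus).
\<close>

class real_or_complex_field = real_normed_field +
  assumes real_or_complex:
    "(\<forall>z. \<exists>a. z = a *\<^sub>R 1) \<or>
     (\<exists>j. j * j = - 1 \<and> (\<forall>z. \<exists>a b. z = a *\<^sub>R 1 + b *\<^sub>R j))"

instance real :: real_or_complex_field
  by standard simp

instance complex :: real_or_complex_field
proof (standard, rule disjI2, rule exI[of _ imaginary_unit], intro conjI allI)
  fix z :: complex
  have "z = Re z *\<^sub>R 1 + Im z *\<^sub>R imaginary_unit"
    by (simp add: complex_eq_iff)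
  then show "\<exists>a b. z = a *\<^sub>R 1 + b *\<^sub>R imaginary_unit" by blast
qed simp

text \<open>
  A Banach space over \<open>'f\<close>: the type \<open>'a\<close> carries the complete norm and the underlying real
  structure, and \<open>scl\<close> is the multiplication by scalars of \<open>'f\<close> extending the real one.
  For \<open>'f = real\<close> it is necessarily \<open>scaleR\<close>.
\<close>

definition banach_over ::
    "('f::real_or_complex_field \<Rightarrow> 'a::banach \<Rightarrow> 'a) \<Rightarrow> bool" where
  "banach_over scl \<longleftrightarrow>
     vector_space scl \<and>
     (\<forall>r x. scl (of_real r) x = r *\<^sub>R x) \<and>
     (\<forall>c x. norm (scl c x) = norm c * norm x)"

definition infinite_dimensional ::
    "('f::real_or_complex_field \<Rightarrow> 'a::banach \<Rightarrow> 'a) \<Rightarrow> bool" where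
  "infinite_dimensional scl \<longleftrightarrow> \<not> (\<exists>S. finite S \<and> module.span scl S = UNIV)"

definition continuous_functional ::
    "('f::real_or_complex_field \<Rightarrow> 'a::banach \<Rightarrow> 'a) \<Rightarrow> ('a \<Rightarrow> 'f) \<Rightarrow> bool" where
  "continuous_functional scl f \<longleftrightarrow> Vector_Spaces.linear scl (*) f \<and> bounded_linear f"

text \<open>
  Sequences are indexed by the positive integers; their values at \<open>0\<close> are never used.
  The functionals \<open>es\<close> are part of the data, but they are uniquely determined (at positive
  indices) by \<open>e\<close>, as the span of the latter is dense.
\<close>

definition is_basis ::
    "('f::real_or_complex_field \<Rightarrow> 'a::banach \<Rightarrow> 'a) \<Rightarrow> (nat \<Rightarrow> 'a) \<Rightarrow> (nat \<Rightarrow> 'a \<Rightarrow> 'f) \<Rightarrow> bool" where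
  "is_basis scl e es \<longleftrightarrow>
     closure (module.span scl (e ` {1..})) = UNIV \<and>
     (\<forall>n\<ge>1. continuous_functional scl (es n)) \<and>
     (\<forall>j\<ge>1. \<forall>k\<ge>1. es j (e k) = (if j = k then 1 else 0)) \<and>
     (let N = (\<lambda>n. norm (e n)) ` {1..} \<union> (\<lambda>n. onorm (es n)) ` {1..}
      in 0 < Inf N \<and> bdd_above N)"

definition proj ::
    "('f::real_or_complex_field \<Rightarrow> 'a::banach \<Rightarrow> 'a) \<Rightarrow> (nat \<Rightarrow> 'a) \<Rightarrow> (nat \<Rightarrow> 'a \<Rightarrow> 'f) \<Rightarrow>
     nat set \<Rightarrow> 'a \<Rightarrow> 'a" where
  "proj scl e es A x = (\<Sum>n\<in>A. scl (es n x) (e n))"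

definition greedy_set ::
    "(nat \<Rightarrow> 'a::banach \<Rightarrow> 'f::real_or_complex_field) \<Rightarrow> 'a \<Rightarrow> nat \<Rightarrow> nat set \<Rightarrow> bool" where
  "greedy_set es x m A \<longleftrightarrow>
     finite A \<and> A \<subseteq> {1..} \<and> card A = m \<and>
     (\<forall>n\<in>A. \<forall>k\<in>{1..} - A. norm (es k x) \<le> norm (es n x))"

text \<open>Below, \<open>n\<close> is the sequence of positive integers \<open>n 1 < n 2 < \<dots>\<close>.\<close>

definition sigma_tilde ::
    "('f::real_or_complex_field \<Rightarrow> 'a::banach \<Rightarrow> 'a) \<Rightarrow> (nat \<Rightarrow> 'a) \<Rightarrow> (nat \<Rightarrow> 'a \<Rightarrow> 'f) \<Rightarrow>
     (nat \<Rightarrow> nat) \<Rightarrow> nat \<Rightarrow> 'a \<Rightarrow> real" where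
  "sigma_tilde scl e es n m x =
     Inf {norm (x - proj scl e es A x) |A. A \<subseteq> n ` {1..} \<and> finite A \<and> card A = m}"

definition consecutive_sets :: "(nat \<Rightarrow> nat) \<Rightarrow> nat \<Rightarrow> nat set set" where
  "consecutive_sets n m = {n ` {k + 1..k + m} |k. True}"

definition sigma_check ::
    "('f::real_or_complex_field \<Rightarrow> 'a::banach \<Rightarrow> 'a) \<Rightarrow> (nat \<Rightarrow> 'a) \<Rightarrow> (nat \<Rightarrow> 'a \<Rightarrow> 'f) \<Rightarrow>
     (nat \<Rightarrow> nat) \<Rightarrow> nat \<Rightarrow> 'a \<Rightarrow> real" where
  "sigma_check scl e es n m x =
     Inf {norm (x - proj scl e es I x) |I. I \<in> consecutive_sets n m}"

definition almost_greedy ::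
    "('f::real_or_complex_field \<Rightarrow> 'a::banach \<Rightarrow> 'a) \<Rightarrow> (nat \<Rightarrow> 'a) \<Rightarrow> (nat \<Rightarrow> 'a \<Rightarrow> 'f) \<Rightarrow>
     (nat \<Rightarrow> nat) \<Rightarrow> bool" where
  "almost_greedy scl e es n \<longleftrightarrow>
     (\<exists>C\<ge>1. \<forall>x. \<forall>m\<ge>1. \<forall>A. greedy_set es x m A \<longrightarrow>
        norm (x - proj scl e es A x) \<le> C * sigma_tilde scl e es n m x)"

definition consecutive_almost_greedy_I ::
    "('f::real_or_complex_field \<Rightarrow> 'a::banach \<Rightarrow> 'a) \<Rightarrow> (nat \<Rightarrow> 'a) \<Rightarrow> (nat \<Rightarrow> 'a \<Rightarrow> 'f) \<Rightarrow>
     (nat \<Rightarrow> nat) \<Rightarrow> bool" where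
  "consecutive_almost_greedy_I scl e es n \<longleftrightarrow>
     (\<exists>C\<ge>1. \<forall>x. \<forall>m\<ge>1. \<forall>A. greedy_set es x m A \<longrightarrow>
        norm (x - proj scl e es A x) \<le> C * sigma_check scl e es n m x)"

end

theory Submission
  imports Defs
begin

text \<open>
  Write \<open>N\<close> for the set of terms of the sequence \<open>n\<close>. As the functionals \<open>es j\<close> are uniformly
  bounded and the span of the basis is dense, the coefficients of every vector tend to \<open>0\<close>, so
  projections onto sets of bounded cardinality lying far out are negligible
  (\<open>proj_far_out_small\<close>). Since \<open>N\<close> is infinite, sets of terms can therefore be padded far out
  or placed far out at an arbitrarily small cost.

  Almost greediness implies the bound by the minimum: a set \<open>I \<subseteq> N\<close> with fewer than \<open>m\<close> elements
  is filled up to exactly \<open>m\<close> elements by terms of \<open>N\<close> that lie far out, which hardly changes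
  \<open>x - P\<^sub>I x\<close>. That bound trivially contains the case \<open>k = m\<close>, which is consecutive almost
  greediness.

  It remains to pass from blocks of consecutive terms to an arbitrary \<open>B \<subseteq> N\<close> of the same
  cardinality as the greedy set \<open>A\<close> of \<open>x\<close>, where \<open>A \<noteq> B\<close> may be assumed. Put
  \<open>D = B - A\<close>, \<open>E = A - B\<close>, so that \<open>|D| = |E|\<close>, and \<open>y = x - P\<^sub>B x\<close>. Then
  \<open>x - P\<^sub>A x = (y - P\<^sub>E y) + P\<^sub>D x\<close>. Let \<open>\<alpha>\<close> be the least modulus of a coefficient of \<open>x\<close> on \<open>E\<close>.
  \<^item> \<open>E\<close> is a greedy set of \<open>y\<close>; comparing it with a far-out block gives
    \<open>\<parallel>y - P\<^sub>E y\<parallel> \<le> C \<parallel>y\<parallel>\<close> (\<open>greedy_residual_le\<close>).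
  \<^item> If \<open>I\<close> is a block far out with \<open>|I| = |E|\<close> and \<open>1\<^sub>I\<close> is the sum of the basis vectors over
    \<open>I\<close>, then \<open>E\<close> is greedy also for \<open>y + \<alpha> 1\<^sub>I\<close> (up to a negligible correction), and removing
    \<open>I\<close> instead shows that \<open>\<alpha> \<parallel>1\<^sub>I\<parallel>\<close> is controlled by \<open>\<parallel>y\<parallel>\<close> (\<open>flat_block_le\<close>).
  \<^item> All coefficients of \<open>P\<^sub>D x\<close> are at most \<open>\<alpha>\<close>. Let \<open>J\<close> be a block containing \<open>D\<close> and disjoint
    from \<open>I\<close>. In \<open>P\<^sub>D x + \<alpha> 1\<^bsub>J - D\<^esub> + \<alpha> 1\<^sub>I\<close> the set \<open>(J - D) \<union> I\<close> is greedy and has as many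
    elements as \<open>J\<close>; removing it leaves \<open>P\<^sub>D x\<close>, removing \<open>J\<close> leaves \<open>\<alpha> 1\<^sub>I\<close>. Hence
    \<open>\<parallel>P\<^sub>D x\<parallel> \<le> C \<alpha> \<parallel>1\<^sub>I\<parallel>\<close> (\<open>subset_le_flat_block\<close>). The filling \<open>\<alpha> 1\<^bsub>J - D\<^esub>\<close> is what makes
    an arbitrary \<open>D \<subseteq> N\<close> accessible to blocks.

  Together, \<open>\<parallel>x - P\<^sub>A x\<parallel> \<le> (C + 2 C\<^sup>2) \<parallel>x - P\<^sub>B x\<parallel>\<close>.
\<close>

section \<open>Coefficients and projections\<close>

locale banach_basis =
  fixes scl :: "'f::real_or_complex_field \<Rightarrow> 'a::banach \<Rightarrow> 'a"
    and e :: "nat \<Rightarrow> 'a"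
    and es :: "nat \<Rightarrow> 'a \<Rightarrow> 'f"
  assumes banach_over: "banach_over scl"
    and is_basis: "is_basis scl e es"
begin

abbreviation P :: "nat set \<Rightarrow> 'a \<Rightarrow> 'a" where
  "P \<equiv> proj scl e es"

definition lincomb :: "nat set \<Rightarrow> (nat \<Rightarrow> 'f) \<Rightarrow> 'a" where
  "lincomb A c = (\<Sum>k\<in>A. scl (c k) (e k))"

sublocale vs: vector_space scl
  using banach_over by (simp add: banach_over_def)

lemma norm_scl: "norm (scl c x) = norm c * norm x"
  using banach_over by (simp add: banach_over_def)

lemma es_linear: "j \<ge> 1 \<Longrightarrow> Vector_Spaces.linear scl (*) (es j)"
  and es_bounded_linear: "j \<ge> 1 \<Longrightarrow> bounded_linear (es j)"
  using is_basis by (auto simp: is_basis_def continuous_functional_def)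

lemma es_biorthogonal: "j \<ge> 1 \<Longrightarrow> k \<ge> 1 \<Longrightarrow> es j (e k) = (if j = k then 1 else 0)"
  using is_basis by (auto simp: is_basis_def)

lemma es_scl: "j \<ge> 1 \<Longrightarrow> es j (scl c x) = c * es j x"
  using es_linear by (simp add: Vector_Spaces.linear_iff)

lemma es_zero: "j \<ge> 1 \<Longrightarrow> es j 0 = 0"
  and es_add: "j \<ge> 1 \<Longrightarrow> es j (x + y) = es j x + es j y"
  and es_diff: "j \<ge> 1 \<Longrightarrow> es j (x - y) = es j x - es j y"
  and es_sum: "j \<ge> 1 \<Longrightarrow> es j (sum g A) = (\<Sum>a\<in>A. es j (g a))"
  using es_bounded_linear[of j] bounded_linear.linear[of "es j"]
  by (simp_all add: linear_0 linear_add linear_diff linear_sum)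

lemma uniform_bound: "\<exists>M>0. \<forall>j\<ge>1. norm (e j) \<le> M \<and> (\<forall>x. norm (es j x) \<le> M * norm x)"
proof -
  have "bdd_above ((\<lambda>n. norm (e n)) ` {1..} \<union> (\<lambda>n. onorm (es n)) ` {1..})"
    using is_basis by (simp add: is_basis_def Let_def)
  then obtain K where K: "\<And>j. j \<ge> 1 \<Longrightarrow> norm (e j) \<le> K" "\<And>j. j \<ge> 1 \<Longrightarrow> onorm (es j) \<le> K"
    unfolding bdd_above_def by auto
  show ?thesis
  proof (intro exI[of _ "max K 1"] conjI allI impI)
    fix j :: nat and x assume j: "j \<ge> 1"
    show "norm (e j) \<le> max K 1" using K(1)[OF j] by simp
    have "norm (es j x) \<le> onorm (es j) * norm x"
      using onorm[OF es_bounded_linear[OF j]] .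
    also have "\<dots> \<le> max K 1 * norm x"
      using K(2)[OF j] by (intro mult_right_mono) auto
    finally show "norm (es j x) \<le> max K 1 * norm x" .
  qed simp
qed

text \<open>
  A vector in the span of the basis has only finitely many nonzero coefficients; the uniform bound
  on the functionals carries this over to the closure in the form of convergence.
\<close>

lemma coefficients_tendsto_0: "(\<lambda>j. es j x) \<longlonglongrightarrow> 0"
proof (rule LIMSEQ_I)
  fix r :: real assume r: "r > 0"
  obtain M where M: "M > 0" "\<And>j. j \<ge> 1 \<Longrightarrow> norm (e j) \<le> M"
    "\<And>j x. j \<ge> 1 \<Longrightarrow> norm (es j x) \<le> M * norm x"
    using uniform_bound by blast
  have "x \<in> closure (vs.span (e ` {1..}))"
    using is_basis by (simp add: is_basis_def)
  then obtain y where y: "y \<in> vs.span (e ` {1..})" "dist y x < r / M"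
    using r M(1) by (auto simp: closure_approachable dest: spec[of _ "r / M"])
  have "\<exists>K\<ge>1. \<forall>j\<ge>K. es j y = 0"
    using y(1)
  proof (induction rule: vs.span_induct_alt)
    case base
    show ?case by (auto intro!: exI[of _ 1] es_zero)
  next
    case (step c u v)
    from step(2) obtain K where K: "K \<ge> 1" "\<And>j. j \<ge> K \<Longrightarrow> es j v = 0" by blast
    from step(1) obtain i where i: "i \<ge> 1" "u = e i" by auto
    have "es j (scl c u + v) = 0" if "j \<ge> max K (Suc i)" for j
      using that K i by (simp add: es_add es_scl es_biorthogonal)
    then show ?case by (intro exI[of _ "max K (Suc i)"]) auto
  qed
  then obtain K where K: "K \<ge> 1" "\<And>j. j \<ge> K \<Longrightarrow> es j y = 0" by blast
  have "norm (es j x - 0) < r" if "j \<ge> K" for j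
  proof -
    have j: "j \<ge> 1" using that K(1) by simp
    have "es j x = es j (x - y)" using K(2)[OF that] j by (simp add: es_diff)
    also have "norm \<dots> \<le> M * norm (x - y)" using M(3) j by blast
    also have "\<dots> < r"
      using y(2) M(1) by (simp add: dist_norm norm_minus_commute field_simps)
    finally show ?thesis by simp
  qed
  then show "\<exists>K. \<forall>j\<ge>K. norm (es j x - 0) < r" by blast
qed

lemma proj_eq_lincomb: "P A x = lincomb A (\<lambda>k. es k x)"
  by (simp add: proj_def lincomb_def)

lemma proj_cong: "(\<And>k. k \<in> A \<Longrightarrow> es k x = es k y) \<Longrightarrow> P A x = P A y"
  by (simp add: proj_def)

lemma proj_union_disjoint:
  "finite A \<Longrightarrow> finite B \<Longrightarrow> A \<inter> B = {} \<Longrightarrow> P (A \<union> B) x = P A x + P B x"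
  by (simp add: proj_def sum.union_disjoint)

lemma es_lincomb:
  assumes "finite A" "A \<subseteq> {1..}" "j \<ge> 1"
  shows "es j (lincomb A c) = (if j \<in> A then c j else 0)"
proof -
  have "es j (lincomb A c) = (\<Sum>k\<in>A. c k * es j (e k))"
    using assms(3) by (simp add: lincomb_def es_sum es_scl)
  also have "\<dots> = (\<Sum>k\<in>A. if j = k then c k else 0)"
    using assms by (intro sum.cong) (auto simp: es_biorthogonal)
  also have "\<dots> = (if j \<in> A then c j else 0)"
    using assms(1) by simp
  finally show ?thesis .
qed

lemma es_proj:
  "finite A \<Longrightarrow> A \<subseteq> {1..} \<Longrightarrow> j \<ge> 1 \<Longrightarrow> es j (P A x) = (if j \<in> A then es j x else 0)"
  by (simp add: proj_eq_lincomb es_lincomb)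

lemma es_residual:
  "finite A \<Longrightarrow> A \<subseteq> {1..} \<Longrightarrow> j \<ge> 1 \<Longrightarrow> es j (x - P A x) = (if j \<in> A then 0 else es j x)"
  by (simp add: es_diff es_proj)

lemma lincomb_residual:
  assumes "finite A" "A \<subseteq> {1..}" "B \<subseteq> A"
  shows "lincomb A c - P B (lincomb A c) = lincomb (A - B) c"
proof -
  have "P B (lincomb A c) = lincomb B c"
    unfolding proj_def lincomb_def[of B]
    using assms by (intro sum.cong) (auto simp: es_lincomb subset_iff)
  then show ?thesis
    using assms by (simp add: lincomb_def sum_diff)
qed

lemma proj_far_out_small:
  fixes x :: 'a and m :: nat
  assumes "\<epsilon> > 0"
  obtains K where "\<And>A. finite A \<Longrightarrow> A \<subseteq> {K..} \<Longrightarrow> card A \<le> m \<Longrightarrow> norm (P A x) \<le> \<epsilon>"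
proof -
  obtain M where M: "M > 0" "\<And>j. j \<ge> 1 \<Longrightarrow> norm (e j) \<le> M"
    "\<And>j x. j \<ge> 1 \<Longrightarrow> norm (es j x) \<le> M * norm x"
    using uniform_bound by blast
  define \<delta> where "\<delta> = \<epsilon> / (M * (real m + 1))"
  have \<delta>: "\<delta> > 0" using assms M(1) by (simp add: \<delta>_def)
  obtain K where K: "\<And>j. j \<ge> K \<Longrightarrow> norm (es j x) < \<delta>"
    using LIMSEQ_D[OF coefficients_tendsto_0[of x] \<delta>] by auto
  show thesis
  proof (rule that[of "max K 1"])
    fix A assume A: "finite A" "A \<subseteq> {max K 1..}" "card A \<le> m"
    have "norm (P A x) \<le> (\<Sum>k\<in>A. \<delta> * M)"
      unfolding proj_def
    proof (rule sum_norm_le)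
      fix k assume "k \<in> A"
      then have "k \<ge> K" "k \<ge> 1" using A(2) by auto
      then show "norm (scl (es k x) (e k)) \<le> \<delta> * M"
        unfolding norm_scl using K[of k] M \<delta> by (intro mult_mono) auto
    qed
    also have "\<dots> = real (card A) * (\<delta> * M)" by simp
    also have "\<dots> \<le> (real m + 1) * (\<delta> * M)"
      using A(3) \<delta> M(1) by (intro mult_right_mono) auto
    also have "\<dots> = \<epsilon>" using M(1) by (simp add: \<delta>_def)
    finally show "norm (P A x) \<le> \<epsilon>" .
  qed
qed

end

section \<open>Blocks of consecutive terms\<close>

locale banach_basis_sequence = banach_basis scl e es
  for scl :: "'f::real_or_complex_field \<Rightarrow> 'a::banach \<Rightarrow> 'a"
    and e :: "nat \<Rightarrow> 'a"
    and es :: "nat \<Rightarrow> 'a \<Rightarrow> 'f" +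
  fixes n :: "nat \<Rightarrow> nat"
  assumes strict_mono_n: "strict_mono_on {1..} n"
    and n_pos: "k \<ge> 1 \<Longrightarrow> n k \<ge> 1"
begin

lemma le_n: "k \<ge> 1 \<Longrightarrow> k \<le> n k"
proof (induction k rule: nat_induct_at_least)
  case base
  then show ?case using n_pos by simp
next
  case (Suc k)
  then show ?case using strict_mono_onD[OF strict_mono_n, of k "Suc k"] by simp
qed

lemma consecutive_setsD:
  assumes "I \<in> consecutive_sets n m"
  shows "I \<subseteq> n ` {1..}" "I \<subseteq> {1..}" "finite I" "card I = m"
proof -
  obtain k where k: "I = n ` {k + 1..k + m}"
    using assms by (auto simp: consecutive_sets_def)
  have "inj_on n {k + 1..k + m}"
    using strict_mono_on_imp_inj_on[OF strict_mono_n] by (rule inj_on_subset) auto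
  then show "card I = m" by (simp add: k card_image)
  show "I \<subseteq> n ` {1..}" "I \<subseteq> {1..}" "finite I" using n_pos by (auto simp: k)
qed

lemma far_out_block:
  obtains I where "I \<in> consecutive_sets n m" "I \<subseteq> {K..}"
proof (rule that)
  show "n ` {K + 1..K + m} \<in> consecutive_sets n m"
    by (auto simp: consecutive_sets_def)
  show "n ` {K + 1..K + m} \<subseteq> {K..}"
  proof
    fix j assume "j \<in> n ` {K + 1..K + m}"
    then obtain i where "j = n i" "i \<ge> K + 1" by auto
    then show "j \<in> {K..}" using le_n[of i] by simp
  qed
qed

text \<open>
  Disjointness from finitely many indices and smallness for a given vector are both achieved by
  placing the block far enough out.
\<close>

lemma negligible_block:
  fixes x :: 'a
  assumes "\<epsilon> > 0" "finite S"
  obtains I where "I \<in> consecutive_sets n m" "I \<inter> S = {}" "norm (P I x) \<le> \<epsilon>"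
proof -
  obtain K where K: "\<And>A. finite A \<Longrightarrow> A \<subseteq> {K..} \<Longrightarrow> card A \<le> m \<Longrightarrow> norm (P A x) \<le> \<epsilon>"
    using proj_far_out_small[OF assms(1)] by blast
  obtain L where L: "\<And>s. s \<in> S \<Longrightarrow> s < L"
    using assms(2) by (auto simp: finite_nat_set_iff_bounded)
  obtain I where I: "I \<in> consecutive_sets n m" "I \<subseteq> {max K L..}"
    by (rule far_out_block)
  show thesis
  proof (rule that[OF I(1)])
    show "I \<inter> S = {}" using I(2) L by fastforce
    show "norm (P I x) \<le> \<epsilon>"
      using I(2) consecutive_setsD[OF I(1)] by (intro K) auto
  qed
qed

lemma block_containing:
  assumes "finite D" "D \<subseteq> n ` {1..}"
  obtains m J where "J \<in> consecutive_sets n m" "D \<subseteq> J"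
proof -
  obtain F where F: "finite F" "F \<subseteq> {1..}" "D = n ` F"
    using assms by (meson finite_subset_image)
  obtain m where "\<And>i. i \<in> F \<Longrightarrow> i \<le> m"
    using F(1) by (auto simp: finite_nat_set_iff_bounded_le)
  then have "D \<subseteq> n ` {0 + 1..0 + m}" using F by auto
  moreover have "n ` {0 + 1..0 + m} \<in> consecutive_sets n m"
    unfolding consecutive_sets_def by blast
  ultimately show thesis using that by blast
qed

section \<open>Best approximation errors as bounds over single sets\<close>

lemma le_mult_Inf_iff:
  fixes a C :: real
  assumes "S \<noteq> {}" "\<And>s. s \<in> S \<Longrightarrow> 0 \<le> s" "C \<ge> 1"
  shows "a \<le> C * Inf S \<longleftrightarrow> (\<forall>s\<in>S. a \<le> C * s)"
proof -
  have "bdd_below S" using assms(2) by (rule bdd_belowI)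
  then have "a / C \<le> Inf S \<longleftrightarrow> (\<forall>s\<in>S. a / C \<le> s)"
    using assms(1) by (simp add: le_cInf_iff)
  then show ?thesis using assms(3) by (simp add: divide_le_eq mult.commute)
qed

lemma le_sigma_check_iff:
  assumes "C \<ge> 1"
  shows "a \<le> C * sigma_check scl e es n m x \<longleftrightarrow>
    (\<forall>I\<in>consecutive_sets n m. a \<le> C * norm (x - P I x))"
  unfolding sigma_check_def
proof (subst le_mult_Inf_iff)
  show "{norm (x - P I x) |I. I \<in> consecutive_sets n m} \<noteq> {}"
    by (auto simp: consecutive_sets_def)
qed (use assms in auto)

lemma le_sigma_tilde_iff:
  assumes "C \<ge> 1"
  shows "a \<le> C * sigma_tilde scl e es n m x \<longleftrightarrow>
    (\<forall>B. B \<subseteq> n ` {1..} \<and> finite B \<and> card B = m \<longrightarrow> a \<le> C * norm (x - P B x))"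
  unfolding sigma_tilde_def
proof (subst le_mult_Inf_iff)
  obtain I where "I \<in> consecutive_sets n m" by (rule far_out_block)
  then show "{norm (x - P A x) |A. A \<subseteq> n ` {1..} \<and> finite A \<and> card A = m} \<noteq> {}"
    using consecutive_setsD[of I m] by auto
qed (use assms in auto)

lemma le_Min_sigma_check_iff:
  assumes "C \<ge> 1"
  shows "a \<le> C * Min ((\<lambda>k. sigma_check scl e es n k x) ` {0..m}) \<longleftrightarrow>
    (\<forall>k\<le>m. a \<le> C * sigma_check scl e es n k x)"
proof -
  have "a / C \<le> Min ((\<lambda>k. sigma_check scl e es n k x) ` {0..m}) \<longleftrightarrow>
    (\<forall>k\<le>m. a / C \<le> sigma_check scl e es n k x)"
    by (subst Min_ge_iff) auto
  then show ?thesis using assms by (simp add: divide_le_eq mult.commute)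
qed

section \<open>Almost greedy bases and smaller blocks\<close>

text \<open>
  The set \<open>B\<close> is padded to cardinality \<open>m\<close> by a block so far out that it changes the residual by
  less than any given amount.
\<close>

lemma almost_greedy_imp_le_smaller:
  assumes ag: "\<And>B. B \<subseteq> n ` {1..} \<Longrightarrow> finite B \<Longrightarrow> card B = m \<Longrightarrow> a \<le> C * norm (x - P B x)"
    and C: "C \<ge> 1"
    and B: "B \<subseteq> n ` {1..}" "finite B" "card B \<le> m"
  shows "a \<le> C * norm (x - P B x)"
proof (rule field_le_epsilon)
  fix \<epsilon> :: real assume "\<epsilon> > 0"
  then have "\<epsilon> / C > 0" using C by simp
  then obtain I where I: "I \<in> consecutive_sets n (m - card B)" "I \<inter> B = {}"
      "norm (P I x) \<le> \<epsilon> / C"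
    using negligible_block[OF _ B(2)] by metis
  note I' = consecutive_setsD[OF I(1)]
  have BI: "B \<inter> I = {}" using I(2) by blast
  have "a \<le> C * norm (x - P (B \<union> I) x)"
    using B I' BI by (intro ag) (auto simp: card_Un_disjoint)
  also have "x - P (B \<union> I) x = (x - P B x) - P I x"
    using B(2) I'(3) BI by (simp add: proj_union_disjoint)
  also have "C * norm \<dots> \<le> C * (norm (x - P B x) + \<epsilon> / C)"
    using C norm_triangle_ineq4[of "x - P B x" "P I x"] I(3) by (intro mult_left_mono) auto
  also have "\<dots> = C * norm (x - P B x) + \<epsilon>"
    using C by (simp add: distrib_left)
  finally show "a \<le> C * norm (x - P B x) + \<epsilon>" .
qed

section \<open>From blocks to arbitrary sets of terms\<close>

context
  fixes C :: real
  assumes C: "C \<ge> 1"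
    and consecutive: "\<And>x m A I. m \<ge> 1 \<Longrightarrow> greedy_set es x m A \<Longrightarrow> I \<in> consecutive_sets n m \<Longrightarrow>
      norm (x - P A x) \<le> C * norm (x - P I x)"
begin

text \<open>
  Comparison with a block on which \<open>x\<close> is negligible, so that \<open>x - P\<^sub>I x\<close> is close to \<open>x\<close>.
\<close>

lemma greedy_residual_le:
  assumes "m \<ge> 1" "greedy_set es x m A"
  shows "norm (x - P A x) \<le> C * norm x"
proof (rule field_le_epsilon)
  fix \<epsilon> :: real assume "\<epsilon> > 0"
  then have "\<epsilon> / C > 0" using C by simp
  then obtain I where I: "I \<in> consecutive_sets n m" "norm (P I x) \<le> \<epsilon> / C"
    using negligible_block[of _ "{}"] by (metis finite.emptyI)
  have "norm (x - P A x) \<le> C * norm (x - P I x)"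
    using consecutive assms I(1) by blast
  also have "\<dots> \<le> C * (norm x + \<epsilon> / C)"
    using C norm_triangle_ineq4[of x "P I x"] I(2) by (intro mult_left_mono) auto
  also have "\<dots> = C * norm x + \<epsilon>"
    using C by (simp add: distrib_left)
  finally show "norm (x - P A x) \<le> C * norm x + \<epsilon>" .
qed

text \<open>
  The vector used is \<open>y\<close> with its coefficients on \<open>I\<close> overwritten by \<open>\<alpha>\<close>: its greedy set \<open>E\<close>
  competes with the block \<open>I\<close>, whose removal leaves only \<open>y - P\<^sub>I y\<close>.
\<close>

lemma flat_block_le:
  assumes m: "m \<ge> 1" and E: "greedy_set es y m E"
    and \<alpha>: "\<alpha> \<ge> 0" "\<And>k. k \<in> E \<Longrightarrow> \<alpha> \<le> norm (es k y)"
      "\<And>k. k \<in> {1..} - E \<Longrightarrow> norm (es k y) \<le> \<alpha>"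
    and I: "I \<in> consecutive_sets n m" "I \<inter> E = {}"
  shows "norm (lincomb I (\<lambda>_. of_real \<alpha>)) \<le> 2 * C * norm y + (C + 1) * norm (P I y)"
proof -
  define f where "f = lincomb I (\<lambda>_. of_real \<alpha>)"
  define w where "w = y - P I y + f"
  note I' = consecutive_setsD[OF I(1)]
  have E': "E \<subseteq> {1..}" using E by (simp add: greedy_set_def)
  have es_w: "es k w = (if k \<in> I then of_real \<alpha> else es k y)" if "k \<ge> 1" for k
    using that I' by (simp add: w_def f_def es_add es_residual es_lincomb)
  have "P I w = f"
    unfolding f_def proj_eq_lincomb lincomb_def using es_w I'(2) by (intro sum.cong) auto
  then have wI: "w - P I w = y - P I y" by (simp add: w_def)
  have es_w_on_E: "es k w = es k y" if "k \<in> E" for k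
  proof -
    have "k \<ge> 1" "k \<notin> I" using that E' I(2) by auto
    then show ?thesis using es_w by simp
  qed
  then have "P E w = P E y" by (rule proj_cong)
  then have wE: "w - P E w = (y - P E y) - P I y + f" by (simp add: w_def)
  have w_off_E: "norm (es k w) \<le> \<alpha>" if "k \<in> {1..} - E" for k
    using that es_w[of k] \<alpha>(1) \<alpha>(3)[OF that] by simp
  have "greedy_set es w m E"
    unfolding greedy_set_def
  proof (intro conjI ballI)
    fix j k assume "j \<in> E" "k \<in> {1..} - E"
    then show "norm (es k w) \<le> norm (es j w)"
      using es_w_on_E w_off_E \<alpha>(2) by (metis order_trans)
  qed (use E in \<open>auto simp: greedy_set_def\<close>)
  then have "norm (w - P E w) \<le> C * norm (w - P I w)"
    using consecutive m I(1) by blast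
  also have "\<dots> \<le> C * (norm y + norm (P I y))"
    unfolding wI using C by (intro mult_left_mono norm_triangle_ineq4) auto
  finally have 1: "norm (w - P E w) \<le> C * norm y + C * norm (P I y)"
    by (simp add: distrib_left)
  have 2: "norm (y - P E y) \<le> C * norm y"
    using greedy_residual_le[OF m E] .
  have "f = (w - P E w) - (y - P E y) + P I y" by (simp add: wE)
  then have "norm f \<le> norm (w - P E w) + norm (y - P E y) + norm (P I y)"
    using norm_triangle_ineq[of "(w - P E w) - (y - P E y)" "P I y"]
      norm_triangle_ineq4[of "w - P E w" "y - P E y"] by simp
  then show ?thesis
    using 1 2 by (simp add: f_def algebra_simps)
qed

text \<open>
  Only whole blocks may be removed, while \<open>D\<close> is an arbitrary part of the block \<open>J\<close>. The gaps of
  \<open>D\<close> in \<open>J\<close> are therefore filled with the coefficient \<open>\<alpha>\<close>, which bounds all moduli on \<open>D\<close>.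
  Filling them makes the gaps part of a greedy set together with \<open>I\<close>, and since \<open>I\<close> has as many
  elements as \<open>D\<close>, this greedy set has as many as \<open>J\<close>. In both residuals the filling is gone.
\<close>

lemma subset_le_flat_block:
  assumes m: "m \<ge> 1" and J: "J \<in> consecutive_sets n m" "D \<subseteq> J"
    and I: "I \<in> consecutive_sets n (card D)" "I \<inter> J = {}"
    and \<alpha>: "\<alpha> \<ge> 0" "\<And>k. k \<in> D \<Longrightarrow> norm (es k x) \<le> \<alpha>"
  shows "norm (P D x) \<le> C * norm (lincomb I (\<lambda>_. of_real \<alpha>))"
proof -
  define c where "c k = (if k \<in> D then es k x else of_real \<alpha>)" for k
  define z where "z = lincomb (J \<union> I) c"
  define G where "G = (J - D) \<union> I"
  note J' = consecutive_setsD[OF J(1)] and I' = consecutive_setsD[OF I(1)]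
  have finD: "finite D" using J(2) J'(3) by (rule finite_subset)
  have sub: "finite (J \<union> I)" "J \<union> I \<subseteq> {1..}" "G \<subseteq> J \<union> I"
    using J' I' by (auto simp: G_def)
  have es_z: "es k z = (if k \<in> J \<union> I then c k else 0)" if "k \<ge> 1" for k
    using that sub unfolding z_def by (subst es_lincomb) auto
  have on_G: "norm (es k z) = \<alpha>" if "k \<in> G" for k
  proof -
    have "k \<ge> 1" "k \<in> J \<union> I" "k \<notin> D"
      using that sub I(2) J(2) by (auto simp: G_def)
    then show ?thesis using es_z[of k] \<alpha>(1) by (simp add: c_def)
  qed
  have off_G: "norm (es k z) \<le> \<alpha>" if "k \<in> {1..} - G" for k
    using that es_z[of k] \<alpha> by (auto simp: c_def G_def)
  have "card G = card (J - D) + card I"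
    using J' I' I(2) unfolding G_def by (intro card_Un_disjoint) auto
  also have "\<dots> = m"
    using J' I' J(2) finD card_mono[OF J'(3) J(2)] by (simp add: card_Diff_subset)
  finally have "greedy_set es z m G"
    unfolding greedy_set_def using on_G off_G sub by (auto intro: finite_subset)
  then have "norm (z - P G z) \<le> C * norm (z - P J z)"
    using consecutive m J(1) by blast
  moreover have "z - P G z = lincomb ((J \<union> I) - G) c"
    using sub by (simp add: z_def lincomb_residual)
  moreover have "(J \<union> I) - G = D"
    using J(2) I(2) by (auto simp: G_def)
  moreover have "lincomb D c = P D x"
    by (simp add: proj_def lincomb_def c_def)
  moreover have "z - P J z = lincomb ((J \<union> I) - J) c"
    using sub by (simp add: z_def lincomb_residual)
  moreover have "(J \<union> I) - J = I"
    using I(2) by auto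
  moreover have "lincomb I c = lincomb I (\<lambda>_. of_real \<alpha>)"
    unfolding lincomb_def c_def using I(2) J(2) by (intro sum.cong) auto
  ultimately show ?thesis by simp
qed

text \<open>
  The two estimates through the flat vector on a far-out block \<open>I\<close> combine to
  \<open>\<parallel>P\<^sub>D x\<parallel> \<le> 2 C\<^sup>2 \<parallel>y\<parallel>\<close>; the remaining part \<open>y - P\<^sub>E y\<close> of \<open>x - P\<^sub>A x\<close> is the residual of a greedy
  set of \<open>y\<close>. All coefficients of \<open>y\<close> on \<open>B\<close> vanish, which is why removing \<open>A \<inter> B\<close> from \<open>A\<close>
  leaves a greedy set.
\<close>

lemma greedy_le_arbitrary_subset:
  assumes A: "greedy_set es x m A"
    and B: "B \<subseteq> n ` {1..}" "finite B" "card B = m"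
  shows "norm (x - P A x) \<le> (C + 2 * C\<^sup>2) * norm (x - P B x)"
proof (cases "A = B")
  case True
  have "1 * norm (x - P A x) \<le> (C + 2 * C\<^sup>2) * norm (x - P A x)"
    using C zero_le_power2[of C] by (intro mult_right_mono) (linarith, simp)
  then show ?thesis using True by simp
next
  case False
  define D E y where "D = B - A" and "E = A - B" and "y = x - P B x"
  have A': "finite A" "A \<subseteq> {1..}" "card A = m"
    using A by (auto simp: greedy_set_def)
  have greedy: "norm (es k x) \<le> norm (es j x)" if "j \<in> A" "k \<ge> 1" "k \<notin> A" for j k
    using A that by (auto simp: greedy_set_def)
  have B': "B \<subseteq> {1..}" using B(1) n_pos by auto
  have card: "card D = card E"
    using A' B card_le_sym_Diff[of A B] card_le_sym_Diff[of B A] by (simp add: D_def E_def)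
  have "\<not> A \<subseteq> B" using False A' B card_subset_eq[of B A] by auto
  then have E_ne: "E \<noteq> {}" by (auto simp: E_def)
  have E': "finite E" "E \<subseteq> {1..}" using A' by (auto simp: E_def)
  have D': "finite D" "D \<subseteq> n ` {1..}" "D \<subseteq> {1..}" using B B' by (auto simp: D_def)
  have cardE: "card E \<ge> 1" using E_ne E' by (simp add: Suc_le_eq card_gt_0_iff)
  have es_y: "es k y = (if k \<in> B then 0 else es k x)" if "k \<ge> 1" for k
    using that B B' by (simp add: y_def es_residual)
  define \<alpha> where "\<alpha> = Min ((\<lambda>k. norm (es k x)) ` E)"
  have \<alpha>_in: "\<alpha> \<in> (\<lambda>k. norm (es k x)) ` E"
    unfolding \<alpha>_def using E' E_ne by (intro Min_in) auto
  have \<alpha>_nonneg: "\<alpha> \<ge> 0" using \<alpha>_in by auto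
  have \<alpha>_le: "\<alpha> \<le> norm (es k y)" if "k \<in> E" for k
  proof -
    have "\<alpha> \<le> norm (es k x)" unfolding \<alpha>_def using that E' by simp
    then show ?thesis using that es_y[of k] E' by (auto simp: E_def)
  qed
  have outside_A: "norm (es k x) \<le> \<alpha>" if "k \<ge> 1" "k \<notin> A" for k
    using \<alpha>_in greedy[OF _ that] by (auto simp: E_def)
  have outside_E: "norm (es k y) \<le> \<alpha>" if "k \<in> {1..} - E" for k
    using that es_y[of k] outside_A[of k] \<alpha>_nonneg by (auto simp: E_def)
  have E_greedy: "greedy_set es y (card E) E"
    unfolding greedy_set_def using E' \<alpha>_le outside_E by (meson order_trans)
  obtain q J where J: "J \<in> consecutive_sets n q" "D \<subseteq> J"
    using block_containing[OF D'(1,2)] .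
  note J' = consecutive_setsD[OF J(1)]
  \<comment> \<open>the hypothesis on blocks concerns greedy sets of positive order only\<close>
  have "q \<ge> 1" using J J' card cardE card_mono[of J D] by simp
  have PD: "norm (P D x) \<le> 2 * C\<^sup>2 * norm y"
  proof (rule field_le_epsilon)
    fix \<epsilon> :: real assume "\<epsilon> > 0"
    \<comment> \<open>the error \<open>t\<close> for \<open>I\<close> enters with the factor \<open>C + 1\<close> and then with the factor \<open>C\<close>\<close>
    define t where "t = \<epsilon> / (C * (C + 1))"
    have t: "C * ((C + 1) * t) = \<epsilon>"
      using C by (simp add: t_def)
    have "t > 0" using C \<open>\<epsilon> > 0\<close> by (simp add: t_def)
    moreover have "finite (E \<union> J)" using E' J' by simp
    ultimately obtain I where I: "I \<in> consecutive_sets n (card E)" "I \<inter> (E \<union> J) = {}"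
        "norm (P I y) \<le> t"
      by (rule negligible_block)
    have "norm (P D x) \<le> C * norm (lincomb I (\<lambda>_. of_real \<alpha>))"
    proof (rule subset_le_flat_block[OF \<open>q \<ge> 1\<close> J])
      show "norm (es k x) \<le> \<alpha>" if "k \<in> D" for k
        using that D' outside_A[of k] by (auto simp: D_def)
    qed (use I card \<alpha>_nonneg in auto)
    also have "\<dots> \<le> C * (2 * C * norm y + (C + 1) * norm (P I y))"
      using C I by (intro mult_left_mono flat_block_le[OF cardE E_greedy])
        (auto simp: \<alpha>_nonneg \<alpha>_le outside_E)
    also have "\<dots> \<le> C * (2 * C * norm y + (C + 1) * t)"
      using C I(3) by (intro mult_left_mono add_left_mono) auto
    also have "\<dots> = 2 * C\<^sup>2 * norm y + C * ((C + 1) * t)"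
      by (simp add: distrib_left power2_eq_square)
    also have "C * ((C + 1) * t) = \<epsilon>" by (rule t)
    finally show "norm (P D x) \<le> 2 * C\<^sup>2 * norm y + \<epsilon>" .
  qed
  have "P (A \<union> D) x = P (B \<union> E) x" by (simp add: D_def E_def Un_commute)
  then have "P A x + P D x = P B x + P E x"
    using A' B D' E' by (subst (asm) (1 2) proj_union_disjoint) (auto simp: D_def E_def)
  moreover have "P E y = P E x"
    using es_y E' by (intro proj_cong) (auto simp: E_def)
  ultimately have "x - P A x = (y - P E y) + P D x"
    by (simp add: y_def algebra_simps)
  then have "norm (x - P A x) \<le> norm (y - P E y) + norm (P D x)"
    by (metis norm_triangle_ineq)
  also have "\<dots> \<le> C * norm y + 2 * C\<^sup>2 * norm y"
    using greedy_residual_le[OF cardE E_greedy] PD by (rule add_mono)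
  finally show ?thesis by (simp add: y_def algebra_simps)
qed

end

section \<open>The equivalence\<close>

lemma almost_greedy_imp_le_Min_sigma_check:
  assumes "almost_greedy scl e es n"
  shows "\<exists>C\<ge>1. \<forall>x. \<forall>m\<ge>1. \<forall>A. greedy_set es x m A \<longrightarrow>
    norm (x - P A x) \<le> C * Min ((\<lambda>k. sigma_check scl e es n k x) ` {0..m})"
proof -
  obtain C where C: "C \<ge> 1" and bound: "\<forall>x. \<forall>m\<ge>1. \<forall>A. greedy_set es x m A \<longrightarrow>
      norm (x - P A x) \<le> C * sigma_tilde scl e es n m x"
    using assms unfolding almost_greedy_def by blast
  have "norm (x - P A x) \<le> C * norm (x - P I x)"
    if "m \<ge> 1" "greedy_set es x m A" "k \<le> m" "I \<in> consecutive_sets n k" for x m A k I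
  proof (rule almost_greedy_imp_le_smaller[where m = m])
    show "norm (x - P A x) \<le> C * norm (x - P B x)"
      if "B \<subseteq> n ` {1..}" "finite B" "card B = m" for B
    proof -
      have "norm (x - P A x) \<le> C * sigma_tilde scl e es n m x"
        using bound \<open>m \<ge> 1\<close> \<open>greedy_set es x m A\<close> by simp
      then show ?thesis using that le_sigma_tilde_iff[OF C] by simp
    qed
  qed (use that C consecutive_setsD[of I k] in auto)
  then show ?thesis
    using C by (intro exI[of _ C]) (simp add: le_Min_sigma_check_iff le_sigma_check_iff)
qed

lemma consecutive_almost_greedy_imp_almost_greedy:
  assumes "consecutive_almost_greedy_I scl e es n"
  shows "almost_greedy scl e es n"
proof -
  obtain C where C: "C \<ge> 1" and bound: "\<forall>x. \<forall>m\<ge>1. \<forall>A. greedy_set es x m A \<longrightarrow>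
      norm (x - P A x) \<le> C * sigma_check scl e es n m x"
    using assms unfolding consecutive_almost_greedy_I_def by blast
  have consecutive: "norm (x - P A x) \<le> C * norm (x - P I x)"
    if "m \<ge> 1" "greedy_set es x m A" "I \<in> consecutive_sets n m" for x m A I
  proof -
    have "norm (x - P A x) \<le> C * sigma_check scl e es n m x"
      using bound that(1,2) by simp
    then show ?thesis using that(3) le_sigma_check_iff[OF C] by simp
  qed
  have C': "C + 2 * C\<^sup>2 \<ge> 1" using C zero_le_power2[of C] by linarith
  show ?thesis
    unfolding almost_greedy_def
  proof (intro exI[of _ "C + 2 * C\<^sup>2"] conjI allI impI)
    fix x m A assume A: "greedy_set es x m A"
    show "norm (x - P A x) \<le> (C + 2 * C\<^sup>2) * sigma_tilde scl e es n m x"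
      unfolding le_sigma_tilde_iff[OF C']
    proof (intro allI impI)
      fix B assume "B \<subseteq> n ` {1..} \<and> finite B \<and> card B = m"
      then show "norm (x - P A x) \<le> (C + 2 * C\<^sup>2) * norm (x - P B x)"
        using A C by (intro greedy_le_arbitrary_subset consecutive) auto
    qed
  qed (rule C')
qed

end

theorem theorem6p7:
  fixes scl :: "'f::real_or_complex_field \<Rightarrow> 'a::banach \<Rightarrow> 'a"
    and e :: "nat \<Rightarrow> 'a"
    and es :: "nat \<Rightarrow> 'a \<Rightarrow> 'f"
    and n :: "nat \<Rightarrow> nat"
  assumes "banach_over scl"
    and "separable_space (euclidean :: 'a topology)"
    and "infinite_dimensional scl"
    and "is_basis scl e es"
    and "strict_mono_on {1..} n"
    and "\<forall>k\<ge>1. n k \<ge> 1"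
  shows "(almost_greedy scl e es n \<longleftrightarrow>
          (\<exists>C\<ge>1. \<forall>x. \<forall>m\<ge>1. \<forall>A. greedy_set es x m A \<longrightarrow>
             norm (x - proj scl e es A x)
               \<le> C * Min ((\<lambda>k. sigma_check scl e es n k x) ` {0..m})))
       \<and> (almost_greedy scl e es n \<longleftrightarrow> consecutive_almost_greedy_I scl e es n)"
proof -
  interpret banach_basis_sequence scl e es n
    using assms by unfold_locales auto
  let ?min = "\<exists>C\<ge>1. \<forall>x. \<forall>m\<ge>1. \<forall>A. greedy_set es x m A \<longrightarrow>
    norm (x - proj scl e es A x)
      \<le> C * Min ((\<lambda>k. sigma_check scl e es n k x) ` {0..m})"
  have "almost_greedy scl e es n \<Longrightarrow> ?min"
    by (rule almost_greedy_imp_le_Min_sigma_check)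
  moreover have "consecutive_almost_greedy_I scl e es n" if ?min
  proof -
    obtain C where C: "C \<ge> 1" and bound: "\<forall>x. \<forall>m\<ge>1. \<forall>A. greedy_set es x m A \<longrightarrow>
        norm (x - P A x) \<le> C * Min ((\<lambda>k. sigma_check scl e es n k x) ` {0..m})"
      using \<open>?min\<close> by blast
    have "norm (x - P A x) \<le> C * sigma_check scl e es n m x"
      if "m \<ge> 1" "greedy_set es x m A" for x m A
    proof -
      have "norm (x - P A x) \<le> C * Min ((\<lambda>k. sigma_check scl e es n k x) ` {0..m})"
        using bound that by simp
      then show ?thesis using le_Min_sigma_check_iff[OF C] by simp
    qed
    then show ?thesis
      unfolding consecutive_almost_greedy_I_def using C by (intro exI[of _ C]) simp
  qed
  moreover have "consecutive_almost_greedy_I scl e es n \<Longrightarrow> almost_greedy scl e es n"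
    by (rule consecutive_almost_greedy_imp_almost_greedy)
  ultimately show ?thesis by blast
qed

end
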